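(* Let $E$ be an infinite-dimensional polyhedral real Banach space satisfying property $( ** )$, let $\varepsilon>0$, and let $X$ be the Banach space obtained from $E$ and $\varepsilon$ by the construction described in the context. Then $$B_X=\overline{\mathrm{conv}}\bigl(\mathrm{ext}(B_X)\bigr)=\overline{\mathrm{conv}}\bigl(\mathrm{str\,exp}(B_X)\bigr).$$
   Context: **Notation.** For a real Banach space $E$: $B_E$, $S_E$ are the closed unit ball and unit sphere; $\mathrm{ext}(K)$ is the set of extreme points of $K$; $\overline{\mathrm{conv}}$ is the norm-closed convex hull; $\mathrm{dens}(E)$ is the density character. For $x\in S_E$, $D_E(x)=\{x^*\in S_{E^*}: x^*(x)=1\}$. **Strongly exposed points.** Let $K$ be a nonempty closed convex set. For $x^*\neq0$ bounded above on $K$ and $\alpha>0$, let $S(K,x^*,\alpha)=\{y\in K: x^*(y)>\sup x^*(K)-\alpha\}$. A point $x\in K$ is strongly exposed if there is a nonzero continuous linear functional $x^*$ with $x^*(x)=\sup x^*(K)$ such that for each norm neighbourhood $V$ of $x$ there is $\alpha>0$ with $S(K,x^*,\alpha)\subset V$. $\mathrm{str\,exp}(K)$ is the set of strongly exposed points of $K$. **Polyhedrality and true faces.** $E$ is polyhedral if the unit ball of each finite-dimensional subspace is a polytope (convex hull of finitely many points). A set $F\subset S_E$ is a true face of $B_E$ if there is $f\in S_{E^*}$ such that, with $H=f^{-1}(1)$, $F=H\cap B_E$ and the relative interior $\mathrm{int}_H F$ of $F$ in $H$ is nonempty. If $E$ is an infinite-dimensional polyhedral space, the minimal boundary of $E$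 is $\mathcal{B}_0=\{f\in S_{E^*}: f^{-1}(1)\cap B_E \text{ is a true face of } B_E\}$; it is known that for each $x\in E$ some $f\in\mathcal{B}_0$ satisfies $f(x)=\|x\|$, and that $\mathrm{card}(\mathcal{B}_0)=\mathrm{dens}(E)=\mathrm{dens}(E^* )$. **Property $( ** )$.** A polyhedral space $E$ satisfies $( ** )$ if $\sup\{f(x): f\in\mathcal{B}_0\setminus D_E(x)\}<1$ for every $x\in S_E$ at which the norm of $E$ is Fréchet differentiable. **Construction of $X$.** Let $E$ be infinite-dimensional, polyhedral, with $( ** )$, norm $\|\cdot\|$, and $\varepsilon>0$. Let $\Gamma=\mathrm{card}(\mathcal{B}_0)$, an infinite cardinal identified with the interval of ordinals $[0,\Gamma)$. Write $\mathcal{B}_0$ as the disjoint union of $\{f^+_\gamma\}_{\gamma<\Gamma}$ and $\{f^-_\gamma\}_{\gamma<\Gamma}$ (without repetitions) with $f^-_\gamma=-f^+_\gamma$; put $H^\pm_\gamma=(f^\pm_\gamma)^{-1}(1)$, $S^\pm_\gamma=H^\pm_\gamma\cap B_E$. Fix $\theta:[0,\Gamma)\to(0,\varepsilon)$ with $\inf_{\gamma\ge\eta}\theta(\gamma)=0$ for every $\eta<\Gamma$, and a family $\{x_\gamma\}_{\gamma<\Gamma}$ dense in $B_E$. Let $J=(0,\omega)$ if $\Gamma=\omega$ and $J=(\omega,\Gamma)$ if $\Gamma>\omega$. By (transfinite) induction on $\gamma\in J$ do the following (all choices are possible). Let $W^\gamma=\{x_\eta:\eta<\gamma\}\cup\bigcup_{\delta\in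 J,\,\delta<\gamma}E_\delta$. If $\Gamma=\omega$, $W^\gamma$ is finite and we enumerate it as $\{z^\gamma_\eta\}_{\eta<\kappa_\gamma}$ with $\kappa_\gamma$ a positive integer; if $\Gamma>\omega$, $\mathrm{card}(W^\gamma)=\mathrm{card}(\gamma)$ and we enumerate it as $\{z^\gamma_\eta\}_{\eta<\kappa_\gamma}$ with $\kappa_\gamma=\gamma$. By induction on $\eta<\kappa_\gamma$ choose a finite nonempty set $A^\gamma_\eta\subset[0,\Gamma)$ disjoint from $\bigcup_{\delta\in J,\delta<\gamma}A_\delta\cup\bigcup_{v<\eta}A^\gamma_v$ and, for each $w\in A^\gamma_\eta$, points $e^+_w\in\mathrm{int}_{H^+_w}(S^+_w)$, $e^-_w\in\mathrm{int}_{H^-_w}(S^-_w)$ and numbers $\lambda^+_w,\lambda^-_w\ge0$ with $\sum_{w\in A^\gamma_\eta}(\lambda^+_w+\lambda^-_w)=1$ and $$z^\gamma_\eta\in\sum_{w\in A^\gamma_\eta}(\lambda^+_we^+_w+\lambda^-_we^-_w)+\theta(\gamma)B_E .$$ Set $A_\gamma=\bigcup_{\eta<\kappa_\gamma}A^\gamma_\eta$ and $E_\gamma=\{e^+_w,e^-_w: w\in A_\gamma\}$. Finally let $A=\bigcup_{\gamma\in J}A_\gamma$ and, for $\gamma<\Gamma$, let $e_\gamma=e^+_\gamma$ if $\gamma\in A$ and $\lambda^+_\gamma\ge\lambda^-_\gamma$; $e_\gamma=-e^-_\gamma$ if $\gamma\in A$ and $\lambda^+_\gamma<\lambda^-_\gamma$;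 and $e_\gamma$ an arbitrary element of $\mathrm{int}_{H^+_\gamma}(S^+_\gamma)$ if $\gamma\notin A$. By $( ** )$, $\mu_\gamma:=\sup_{\xi\ne\gamma}|f^+_\xi(e_\gamma)|<1$; choose $\theta_\gamma\in(0,\varepsilon)$ with $\theta_\gamma+\mu_\gamma+\theta_\gamma\mu_\gamma<1$. Put $$B=\overline{\mathrm{conv}}\bigl(\{\pm(1+\theta_\gamma)e_\gamma:\gamma\in[0,\Gamma)\}\bigr).$$ One has $B_E\subset B\subset(1+\varepsilon)B_E$; $X$ is $E$ with the equivalent norm whose closed unit ball is $B_X=B$. *)

theory Defs
  imports "HOL-Analysis.Analysis"
begin

text \<open>
  The dual of a real normed space \<open>'a\<close> is the library's type \<open>'a \<Rightarrow>\<^sub>L real\<close>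
  with the operator norm.
\<close>

definition finite_dimensional_set :: "'a::real_vector set \<Rightarrow> bool" where
  "finite_dimensional_set V \<longleftrightarrow> (\<exists>S. finite S \<and> V = span S)"

definition infinite_dimensional :: "'a::real_vector itself \<Rightarrow> bool" where
  "infinite_dimensional _ \<longleftrightarrow> \<not> finite_dimensional_set (UNIV :: 'a set)"

definition polyhedral :: "'a::real_normed_vector itself \<Rightarrow> bool" where
  "polyhedral _ \<longleftrightarrow>
     (\<forall>V :: 'a set. finite_dimensional_set V \<longrightarrow> polytope (V \<inter> cball 0 1))"

definition duality :: "'a::real_normed_vector \<Rightarrow> ('a \<Rightarrow>\<^sub>L real) set" where
  "duality x = {f :: 'a \<Rightarrow>\<^sub>L real. norm f = 1 \<and> blinfun_apply f x = 1}"


section \<open>True faces and the minimal boundary\<close>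

definition face :: "('a::real_normed_vector \<Rightarrow>\<^sub>L real) \<Rightarrow> 'a set" where
  "face f = {x. blinfun_apply f x = 1} \<inter> cball 0 1"

text \<open>The interior of \<open>face f\<close> relative to the hyperplane \<open>f\<^sup>-\<^sup>1(1)\<close>
  (not relative to its own affine hull).\<close>

definition face_interior :: "('a::real_normed_vector \<Rightarrow>\<^sub>L real) \<Rightarrow> 'a set" where
  "face_interior f = top_of_set {x. blinfun_apply f x = 1} interior_of face f"

definition true_face :: "'a::real_normed_vector set \<Rightarrow> bool" where
  "true_face F \<longleftrightarrow> (\<exists>f :: 'a \<Rightarrow>\<^sub>L real. norm f = 1 \<and> F = face f \<and> face_interior f \<noteq> {})"

definition minimal_boundary :: "('a::real_normed_vector \<Rightarrow>\<^sub>L real) set" where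
  "minimal_boundary = {f :: 'a \<Rightarrow>\<^sub>L real. norm f = 1 \<and> true_face (face f)}"

definition property_double_star :: "'a::real_normed_vector itself \<Rightarrow> bool" where
  "property_double_star _ \<longleftrightarrow>
     (\<forall>x::'a. norm x = 1 \<and> (norm :: 'a \<Rightarrow> real) differentiable (at x) \<longrightarrow>
        (SUP f \<in> (minimal_boundary :: ('a \<Rightarrow>\<^sub>L real) set) - duality x. blinfun_apply f x) < 1)"


section \<open>Renormings and strongly exposed points\<close>

text \<open>
  A second norm on \<open>'a\<close> is represented by a function \<open>N :: 'a \<Rightarrow> real\<close>. Topological notions of the
  renormed space are taken in the topology induced by \<open>N\<close>. The norm with a given closed unit
  ball \<open>B\<close> is the Minkowski functional of \<open>B\<close>.
\<close>

definition minkowski_functional :: "'a::real_vector set \<Rightarrow> 'a \<Rightarrow> real" where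
  "minkowski_functional B x = Inf {t. 0 < t \<and> x \<in> (\<lambda>b. t *\<^sub>R b) ` B}"

definition norm_topology :: "('a::real_vector \<Rightarrow> real) \<Rightarrow> 'a topology" where
  "norm_topology N = Metric_space.mtopology UNIV (\<lambda>x y. N (x - y))"

definition norm_ball :: "('a \<Rightarrow> real) \<Rightarrow> 'a set" where
  "norm_ball N = {x. N x \<le> 1}"

definition closed_conv :: "('a::real_vector \<Rightarrow> real) \<Rightarrow> 'a set \<Rightarrow> 'a set" where
  "closed_conv N S = norm_topology N closure_of (convex hull S)"

definition ext :: "'a::real_vector set \<Rightarrow> 'a set" where
  "ext K = {x. x extreme_point_of K}"

definition slice :: "'a set \<Rightarrow> ('a \<Rightarrow> real) \<Rightarrow> real \<Rightarrow> 'a set" where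
  "slice K g \<alpha> = {y \<in> K. g y > Sup (g ` K) - \<alpha>}"

definition str_exp :: "('a::real_vector \<Rightarrow> real) \<Rightarrow> 'a set \<Rightarrow> 'a set" where
  "str_exp N K = {x \<in> K. \<exists>g :: 'a \<Rightarrow> real.
     linear g \<and> continuous_map (norm_topology N) euclideanreal g \<and> (\<exists>y. g y \<noteq> 0) \<and>
     bdd_above (g ` K) \<and> g x = Sup (g ` K) \<and>
     (\<forall>V. openin (norm_topology N) V \<and> x \<in> V \<longrightarrow> (\<exists>\<alpha>>0. slice K g \<alpha> \<subseteq> V))}"


section \<open>The construction of the renorming\<close>

text \<open>
  The cardinal \<open>\<Gamma>\<close>, viewed as the initial segment \<open>[0,\<Gamma>)\<close> of the ordinals, is represented by a
  well-ordered type \<open>'i\<close> all of whose proper initial segments have smaller cardinality than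
  \<open>'i\<close> itself.

  Data: \<open>f \<gamma> = f\<^sup>+\<^sub>\<gamma>\<close> (and \<open>f\<^sup>-\<^sub>\<gamma> = - f \<gamma>\<close>), \<open>\<theta> \<gamma> = \<theta>(\<gamma>)\<close>, the dense family \<open>x\<close>, the
  enumerations \<open>z \<gamma> \<eta> = z\<^sup>\<gamma>\<^sub>\<eta>\<close> for \<open>\<eta> < \<kappa> \<gamma>\<close>, the finite sets \<open>S \<gamma> \<eta> = A\<^sup>\<gamma>\<^sub>\<eta>\<close>, the points
  \<open>ep w = e\<^sup>+\<^sub>w\<close>, \<open>em w = e\<^sup>-\<^sub>w\<close>, the weights \<open>lp w = \<lambda>\<^sup>+\<^sub>w\<close>, \<open>lm w = \<lambda>\<^sup>-\<^sub>w\<close>, the points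
  \<open>e \<gamma> = e\<^sub>\<gamma>\<close> and the numbers \<open>\<tau> \<gamma> = \<theta>\<^sub>\<gamma>\<close>. As the sets \<open>S \<gamma> \<eta>\<close> are pairwise disjoint, \<open>ep\<close>,
  \<open>em\<close>, \<open>lp\<close>, \<open>lm\<close> need only the index \<open>w\<close>; their values off the union of these sets are
  irrelevant.
\<close>

locale renorming_data =
  fixes \<epsilon> :: real
    and f :: "'i::wellorder \<Rightarrow> ('a::real_normed_vector \<Rightarrow>\<^sub>L real)"
    and \<theta> :: "'i \<Rightarrow> real"
    and x :: "'i \<Rightarrow> 'a"
    and \<kappa> :: "'i \<Rightarrow> 'i"
    and z :: "'i \<Rightarrow> 'i \<Rightarrow> 'a"
    and S :: "'i \<Rightarrow> 'i \<Rightarrow> 'i set"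
    and ep em :: "'i \<Rightarrow> 'a"
    and lp lm :: "'i \<Rightarrow> real"
    and e :: "'i \<Rightarrow> 'a"
    and \<tau> :: "'i \<Rightarrow> real"
begin

text \<open>\<open>zero\<close> and \<open>omega\<close> are the ordinals \<open>0\<close> and \<open>\<omega>\<close>; the latter exists in \<open>'i\<close> when
  \<open>\<Gamma> > \<omega>\<close>, that is, when \<open>'i\<close> is uncountable.\<close>

definition zero :: 'i where
  "zero = (LEAST \<gamma>. True)"

definition omega :: 'i where
  "omega = (LEAST \<gamma>. infinite {..<\<gamma>})"

definition J :: "'i set" where
  "J = (if countable (UNIV :: 'i set) then {zero<..} else {omega<..})"

definition A_stage :: "'i \<Rightarrow> 'i set" where
  "A_stage \<gamma> = (\<Union>\<eta>\<in>{..<\<kappa> \<gamma>}. S \<gamma> \<eta>)"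

definition E_stage :: "'i \<Rightarrow> 'a set" where
  "E_stage \<gamma> = ep ` A_stage \<gamma> \<union> em ` A_stage \<gamma>"

definition W :: "'i \<Rightarrow> 'a set" where
  "W \<gamma> = x ` {..<\<gamma>} \<union> (\<Union>\<delta>\<in>{\<delta> \<in> J. \<delta> < \<gamma>}. E_stage \<delta>)"

definition A :: "'i set" where
  "A = (\<Union>\<gamma>\<in>J. A_stage \<gamma>)"

definition \<mu> :: "'i \<Rightarrow> real" where
  "\<mu> \<gamma> = (SUP \<xi>\<in>-{\<gamma>}. \<bar>blinfun_apply (f \<xi>) (e \<gamma>)\<bar>)"

definition B :: "'a set" where
  "B = closure (convex hull
         (range (\<lambda>\<gamma>. (1 + \<tau> \<gamma>) *\<^sub>R e \<gamma>) \<union> range (\<lambda>\<gamma>. - ((1 + \<tau> \<gamma>) *\<^sub>R e \<gamma>))))"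

definition norm_X :: "'a \<Rightarrow> real" where
  "norm_X = minkowski_functional B"

end

locale renorming_construction = renorming_data \<epsilon> f \<theta> x \<kappa> z S ep em lp lm e \<tau>
  for \<epsilon> :: real
    and f :: "'i::wellorder \<Rightarrow> ('a::real_normed_vector \<Rightarrow>\<^sub>L real)"
    and \<theta> x \<kappa> z S ep em lp lm e \<tau> +
  \<comment> \<open>the index type is the cardinal \<open>card(\<B>\<^sub>0)\<close>\<close>
  assumes initial: "\<And>\<gamma> :: 'i. {..<\<gamma>} \<prec> (UNIV :: 'i set)"
    and card_index: "(UNIV :: 'i set) \<approx> (minimal_boundary :: ('a \<Rightarrow>\<^sub>L real) set)"
  \<comment> \<open>\<open>\<B>\<^sub>0\<close> is the disjoint union of \<open>{f\<^sup>+\<^sub>\<gamma>}\<close> and \<open>{f\<^sup>-\<^sub>\<gamma>}\<close>, without repetitions\<close>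
    and f_inj: "inj f"
    and f_disjoint: "range f \<inter> range (\<lambda>\<gamma>. - f \<gamma>) = {}"
    and f_range: "range f \<union> range (\<lambda>\<gamma>. - f \<gamma>) = minimal_boundary"
    and theta_range: "\<And>\<gamma>. 0 < \<theta> \<gamma> \<and> \<theta> \<gamma> < \<epsilon>"
    and theta_inf: "\<And>\<eta>. (INF \<gamma>\<in>{\<eta>..}. \<theta> \<gamma>) = 0"
    and x_ball: "range x \<subseteq> cball 0 1"
    and x_dense: "cball 0 1 \<subseteq> closure (range x)"
  \<comment> \<open>the stages \<open>\<gamma> \<in> J\<close>\<close>
    and kappa_countable: "\<And>\<gamma>. \<gamma> \<in> J \<Longrightarrow> countable (UNIV :: 'i set) \<Longrightarrow> zero < \<kappa> \<gamma>"
    and kappa_uncountable: "\<And>\<gamma>. \<gamma> \<in> J \<Longrightarrow> uncountable (UNIV :: 'i set) \<Longrightarrow> \<kappa> \<gamma> = \<gamma>"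
    and z_enum: "\<And>\<gamma>. \<gamma> \<in> J \<Longrightarrow> z \<gamma> ` {..<\<kappa> \<gamma>} = W \<gamma>"
    and S_finite: "\<And>\<gamma> \<eta>. \<gamma> \<in> J \<Longrightarrow> \<eta> < \<kappa> \<gamma> \<Longrightarrow> finite (S \<gamma> \<eta>) \<and> S \<gamma> \<eta> \<noteq> {}"
    and S_disjoint: "\<And>\<gamma> \<eta>. \<gamma> \<in> J \<Longrightarrow> \<eta> < \<kappa> \<gamma> \<Longrightarrow>
      S \<gamma> \<eta> \<inter> ((\<Union>\<delta>\<in>{\<delta> \<in> J. \<delta> < \<gamma>}. A_stage \<delta>) \<union> (\<Union>v\<in>{..<\<eta>}. S \<gamma> v)) = {}"
    and ep_interior: "\<And>w. w \<in> A \<Longrightarrow> ep w \<in> face_interior (f w)"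
    and em_interior: "\<And>w. w \<in> A \<Longrightarrow> em w \<in> face_interior (- f w)"
    and weights_nonneg: "\<And>w. w \<in> A \<Longrightarrow> 0 \<le> lp w \<and> 0 \<le> lm w"
    and weights_sum: "\<And>\<gamma> \<eta>. \<gamma> \<in> J \<Longrightarrow> \<eta> < \<kappa> \<gamma> \<Longrightarrow> (\<Sum>w\<in>S \<gamma> \<eta>. lp w + lm w) = 1"
    and z_approx: "\<And>\<gamma> \<eta>. \<gamma> \<in> J \<Longrightarrow> \<eta> < \<kappa> \<gamma> \<Longrightarrow>
      z \<gamma> \<eta> \<in> cball (\<Sum>w\<in>S \<gamma> \<eta>. lp w *\<^sub>R ep w + lm w *\<^sub>R em w) (\<theta> \<gamma>)"
  \<comment> \<open>the final choices\<close>
    and e_plus: "\<And>\<gamma>. \<gamma> \<in> A \<Longrightarrow> lp \<gamma> \<ge> lm \<gamma> \<Longrightarrow> e \<gamma> = ep \<gamma>"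
    and e_minus: "\<And>\<gamma>. \<gamma> \<in> A \<Longrightarrow> lp \<gamma> < lm \<gamma> \<Longrightarrow> e \<gamma> = - em \<gamma>"
    and e_other: "\<And>\<gamma>. \<gamma> \<notin> A \<Longrightarrow> e \<gamma> \<in> face_interior (f \<gamma>)"
    and tau_range: "\<And>\<gamma>. 0 < \<tau> \<gamma> \<and> \<tau> \<gamma> < \<epsilon>"
    and tau_mu: "\<And>\<gamma>. \<tau> \<gamma> + \<mu> \<gamma> + \<tau> \<gamma> * \<mu> \<gamma> < 1"

end

theory Submission
  imports Defs
begin

text \<open>
  The functional \<open>f\<^sub>\<gamma>\<close> equals \<open>1 + \<theta>\<^sub>\<gamma>\<close> at \<open>p = (1 + \<theta>\<^sub>\<gamma>) e\<^sub>\<gamma>\<close>, whereas the choice of the \<open>\<theta>\<^sub>\<xi>\<close>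
  keeps it at most \<open>1\<close> at the other generators of \<open>B\<close>. A convex combination of generators on which
  \<open>f\<^sub>\<gamma>\<close> is almost \<open>1 + \<theta>\<^sub>\<gamma>\<close> therefore puts almost all its weight on \<open>p\<close>, so \<open>p\<close> is strongly exposed
  and \<open>B\<close> is the closed convex hull of its strongly exposed points.

  It remains to see that \<open>B\<close> is the unit ball of an equivalent norm, that is, a neighbourhood of \<open>0\<close>.
  For each pair \<open>e\<^sup>+\<^sub>w, e\<^sup>-\<^sub>w\<close> the one of larger weight is \<open>\<plusminus>e\<^sub>w\<close>, so at least half of the total weight
  in the approximations of the points \<open>x\<^sub>\<eta>\<close> sits on points of \<open>B\<close>. Every \<open>y\<close> in the ball of \<open>E\<close> is
  thus \<open>c / 2 + (3 / 4) y'\<close> with \<open>c\<close> in \<open>B\<close> and \<open>y'\<close> in the ball, and iterating this places \<open>y\<close>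
  in \<open>2 B\<close>.
\<close>

section \<open>Minkowski functionals of bounded symmetric convex bodies\<close>

text \<open>The two balls give \<open>norm x / R\<close> and \<open>norm x / r\<close> as lower and
  upper bounds of the gauge (the lower one when \<open>R\<close> is positive), hence equivalence
  with the ambient norm.\<close>

locale symmetric_body =
  fixes K :: "'a::real_normed_vector set" and r R :: real
  assumes convex_K: "convex K"
    and closed_K: "closed K"
    and symmetric_K: "\<And>x. x \<in> K \<Longrightarrow> - x \<in> K"
    and r_pos: "0 < r"
    and ball_subset_K: "cball 0 r \<subseteq> K"
    and K_subset_ball: "K \<subseteq> cball 0 R"
begin

lemma zero_mem: "0 \<in> K"
  using ball_subset_K r_pos by auto

lemma R_pos: "0 \<le> R"
  using zero_mem K_subset_ball by auto

lemma scaleR_mono: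
  assumes "x \<in> (*\<^sub>R) s ` K" "0 < s" "s \<le> t"
  shows "x \<in> (*\<^sub>R) t ` K"
proof -
  obtain b where b: "b \<in> K" "x = s *\<^sub>R b" using assms by auto
  have "(s / t) *\<^sub>R b + (1 - s / t) *\<^sub>R 0 \<in> K"
    using assms b zero_mem convex_K by (intro convexD) auto
  moreover have "x = t *\<^sub>R ((s / t) *\<^sub>R b)" using assms b by simp
  ultimately show ?thesis by (intro image_eqI[of _ _ "(s / t) *\<^sub>R b"]) simp_all
qed

lemma mem_scaleR_if_norm_le: "norm x \<le> r * t \<Longrightarrow> 0 < t \<Longrightarrow> x \<in> (*\<^sub>R) t ` K"
  using ball_subset_K
  by (intro image_eqI[of _ _ "x /\<^sub>R t"]) (auto simp: divide_simps mult.commute)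

lemma norm_le_if_mem_scaleR: "x \<in> (*\<^sub>R) t ` K \<Longrightarrow> 0 < t \<Longrightarrow> norm x \<le> R * t"
  using K_subset_ball by (force simp: mult.commute intro: mult_left_mono)

abbreviation "N \<equiv> minkowski_functional K"

lemma minkowski_le: "x \<in> (*\<^sub>R) t ` K \<Longrightarrow> 0 < t \<Longrightarrow> N x \<le> t"
  unfolding minkowski_functional_def by (rule cInf_lower) (auto intro: bdd_belowI[of _ 0])

lemma minkowski_set_nonempty: "{t. 0 < t \<and> x \<in> (*\<^sub>R) t ` K} \<noteq> {}"
proof -
  have "norm x \<le> r * (norm x / r + 1)" using r_pos by (simp add: field_simps)
  moreover have "0 < norm x / r + 1" using r_pos by (simp add: add_nonneg_pos)
  ultimately show ?thesis using mem_scaleR_if_norm_le by blast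
qed

lemma mem_scaleR_if_minkowski_less:
  assumes "N x < t" shows "0 < t \<and> x \<in> (*\<^sub>R) t ` K"
proof -
  obtain s where "0 < s" "x \<in> (*\<^sub>R) s ` K" "s < t"
    using cInf_lessD[OF minkowski_set_nonempty, of x t] assms
    unfolding minkowski_functional_def by blast
  then show ?thesis using scaleR_mono[of x s t] by auto
qed

lemma minkowski_nonneg: "0 \<le> N x"
  using mem_scaleR_if_minkowski_less by (meson less_irrefl not_less dense)

lemma minkowski_le_norm: "N x \<le> norm x / r"
proof (rule field_le_epsilon)
  \<comment> \<open>The slack keeps the scaling factor positive when \<open>x = 0\<close>.\<close>
  fix d :: real assume "0 < d"
  then have "norm x \<le> r * (norm x / r + d)" "0 < norm x / r + d"
    using r_pos by (auto simp: field_simps add_nonneg_pos)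
  then show "N x \<le> norm x / r + d" using minkowski_le mem_scaleR_if_norm_le by blast
qed

lemma norm_le_minkowski: "norm x \<le> R * N x"
proof -
  have "norm x \<le> R * N x + R * d" if "0 < d" for d
    using norm_le_if_mem_scaleR[of x "N x + d"] mem_scaleR_if_minkowski_less[of x "N x + d"] that
    by (simp add: algebra_simps)
  note * = this
  show ?thesis
  proof (rule field_le_epsilon)
    fix d :: real assume "0 < d"
    \<comment> \<open>In the trivial space \<open>R\<close> may be 0, so the slack is divided by
      \<open>R + 1\<close>.\<close>
    then have "norm x \<le> R * N x + R * (d / (R + 1))" using R_pos by (intro *) auto
    also have "R * (d / (R + 1)) \<le> d" using R_pos \<open>0 < d\<close> by (simp add: field_simps)
    finally show "norm x \<le> R * N x + d" by simp
  qed
qed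

lemma minkowski_minus_commute: "N (x - y) = N (y - x)"
proof -
  have "N (- u) = N u" for u
    unfolding minkowski_functional_def using symmetric_K
    by (intro arg_cong[where f = Inf] Collect_cong)
      (metis (no_types, lifting) add.inverse_inverse image_iff scaleR_minus_right)
  from this[of "x - y"] show ?thesis by simp
qed

lemma minkowski_triangle: "N (x + y) \<le> N x + N y"
proof (rule field_le_epsilon)
  fix d :: real assume "0 < d"
  define s t where st: "s = N x + d / 2" "t = N y + d / 2"
  then have pos: "0 < s" "0 < t" using minkowski_nonneg[of x] minkowski_nonneg[of y] \<open>0 < d\<close> by auto
  obtain a b where ab: "a \<in> K" "b \<in> K" "x = s *\<^sub>R a" "y = t *\<^sub>R b"
    using mem_scaleR_if_minkowski_less[of x s] mem_scaleR_if_minkowski_less[of y t] st \<open>0 < d\<close> by auto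
  have "(s / (s + t)) *\<^sub>R a + (t / (s + t)) *\<^sub>R b \<in> K"
    using pos ab convex_K by (intro convexD) (auto simp: add_divide_distrib[symmetric])
  moreover have "x + y = (s + t) *\<^sub>R ((s / (s + t)) *\<^sub>R a + (t / (s + t)) *\<^sub>R b)"
    using pos ab by (simp add: scaleR_add_right)
  ultimately have "x + y \<in> (*\<^sub>R) (s + t) ` K" by auto
  then have "N (x + y) \<le> s + t" using minkowski_le pos by auto
  then show "N (x + y) \<le> N x + N y + d" using st by simp
qed

lemma norm_ball_minkowski: "norm_ball N = K"
proof
  show "K \<subseteq> norm_ball N"
    using minkowski_le[of _ 1] by (auto simp: norm_ball_def)
  show "norm_ball N \<subseteq> K"
  proof
    fix x assume "x \<in> norm_ball N"
    then have x: "N x \<le> 1" by (simp add: norm_ball_def)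
    \<comment> \<open>If \<open>N x = 1\<close>, the infimum is not yet known to be attained:
      \<open>x\<close> is a limit of points \<open>u n *\<^sub>R x\<close> of \<open>K\<close>, and
      \<open>K\<close> is closed.\<close>
    define u where "u n = inverse (1 + inverse (real (Suc n)))" for n
    have "u n *\<^sub>R x \<in> K" for n
    proof -
      have "N x < 1 + inverse (real (Suc n))"
        using x by (rule le_less_trans) simp
      then obtain b where "b \<in> K" "x = (1 + inverse (real (Suc n))) *\<^sub>R b"
        using mem_scaleR_if_minkowski_less by blast
      moreover have "1 + inverse (real (Suc n)) \<noteq> 0"
        by (metis add_pos_pos inverse_positive_iff_positive less_irrefl of_nat_0_less_iff zero_less_Suc zero_less_one)
      ultimately show ?thesis by (simp add: u_def del: of_nat_Suc)
    qed
    moreover have "u \<longlonglongrightarrow> inverse (1 + 0)"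
      unfolding u_def
      by (rule tendsto_inverse[OF tendsto_add[OF tendsto_const LIMSEQ_inverse_real_of_nat]]) simp
    then have "(\<lambda>n. u n *\<^sub>R x) \<longlonglongrightarrow> inverse (1 + 0) *\<^sub>R x"
      by (rule tendsto_scaleR[OF _ tendsto_const])
    then have "(\<lambda>n. u n *\<^sub>R x) \<longlonglongrightarrow> x" by simp
    ultimately show "x \<in> K" using closed_K by (metis closed_sequentially)
  qed
qed

text \<open>Holds by \<open>minkowski_le_norm\<close> and \<open>norm_le_minkowski\<close>, one for
  each inclusion of topologies. Closures and strong exposure in the renormed space can then be
  treated in the original topology.\<close>

lemma norm_topology_minkowski: "norm_topology N = euclidean"
proof -
  interpret M: Metric_space UNIV "\<lambda>x y. N (x - y)"
  proof
    fix x y z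
    show "0 \<le> N (x - y)" by (rule minkowski_nonneg)
    show "N (x - y) = N (y - x)" by (rule minkowski_minus_commute)
    show "N (x - y) = 0 \<longleftrightarrow> x = y"
      using norm_le_minkowski[of "x - y"] minkowski_le_norm[of 0] minkowski_nonneg[of 0] by auto
    show "N (x - z) \<le> N (x - y) + N (y - z)"
      using minkowski_triangle[of "x - y" "y - z"] by simp
  qed
  have "openin M.mtopology U \<longleftrightarrow> open U" for U
  proof
    assume U: "openin M.mtopology U"
    show "open U"
      unfolding open_dist
    proof (intro ballI)
      fix x assume "x \<in> U"
      then obtain t where t: "t > 0" "M.mball x t \<subseteq> U" using U unfolding M.openin_mtopology by blast
      have "y \<in> U" if "dist y x < r * t" for y
      proof -
        have "N (x - y) \<le> norm (x - y) / r" by (rule minkowski_le_norm)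
        also have "\<dots> < t" using that r_pos by (simp add: dist_norm norm_minus_commute field_simps)
        finally show ?thesis using t by auto
      qed
      then show "\<exists>e>0. \<forall>y. dist y x < e \<longrightarrow> y \<in> U"
        using t r_pos by (intro exI[of _ "r * t"]) auto
    qed
  next
    assume U: "open U"
    show "openin M.mtopology U"
      unfolding M.openin_mtopology
    proof (intro conjI allI impI)
      fix x assume "x \<in> U"
      then obtain t where t: "t > 0" "\<And>y. dist y x < t \<Longrightarrow> y \<in> U" using U unfolding open_dist by blast
      have "y \<in> U" if "N (x - y) < t / (R + 1)" for y
      proof -
        have "norm (x - y) \<le> R * N (x - y)" by (rule norm_le_minkowski)
        also have "\<dots> \<le> (R + 1) * N (x - y)" using minkowski_nonneg by (intro mult_right_mono) auto
        also have "\<dots> < t" using that R_pos by (simp add: field_simps)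
        finally show ?thesis using t by (simp add: dist_norm norm_minus_commute)
      qed
      then show "\<exists>s>0. M.mball x s \<subseteq> U"
        using t R_pos by (intro exI[of _ "t / (R + 1)"]) auto
    qed simp
  qed
  then show ?thesis unfolding norm_topology_def by (intro topology_eq[THEN iffD2]) simp
qed

end


section \<open>Strongly exposed points\<close>

text \<open>A second maximiser of \<open>g\<close> would lie in every slice, although its complement
  is a neighbourhood of \<open>p\<close>. So \<open>p\<close> is the only maximiser, and both ends
  of a segment of \<open>K\<close> with \<open>p\<close> in its interior would be maximisers
  too.\<close>

lemma str_exp_subset_ext:
  fixes K :: "'a::real_normed_vector set"
  assumes "norm_topology N = euclidean"
  shows "str_exp N K \<subseteq> ext K"
proof
  fix p assume "p \<in> str_exp N K"
  then obtain g where p: "p \<in> K" and g: "linear g" "bdd_above (g ` K)" "g p = Sup (g ` K)"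
    and sl: "\<And>V. open V \<Longrightarrow> p \<in> V \<Longrightarrow> \<exists>\<alpha>>0. slice K g \<alpha> \<subseteq> V"
    unfolding str_exp_def assms by auto
  have le: "g y \<le> g p" if "y \<in> K" for y
    using that g by (simp add: cSup_upper)
  have unique: "y = p" if "y \<in> K" "g y = g p" for y
  proof (rule ccontr)
    assume "y \<noteq> p"
    then obtain \<alpha> where "\<alpha> > 0" "slice K g \<alpha> \<subseteq> - {y}"
      using sl[of "- {y}"] open_delete[OF open_UNIV, of y] by (auto simp: Compl_eq_Diff_UNIV)
    moreover have "y \<in> slice K g \<alpha>" using that g(3) \<open>\<alpha> > 0\<close> by (simp add: slice_def)
    ultimately show False by auto
  qed
  have "p \<notin> open_segment a b" if "a \<in> K" "b \<in> K" for a b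
  proof
    assume "p \<in> open_segment a b"
    then obtain u where u: "0 < u" "u < 1" "a \<noteq> b" "p = (1 - u) *\<^sub>R a + u *\<^sub>R b"
      by (auto simp: in_segment)
    have "g p = (1 - u) * g a + u * g b"
      unfolding u(4) linear_add[OF g(1)] linear_cmul[OF g(1)] by simp
    then have eq: "(1 - u) * (g p - g a) + u * (g p - g b) = 0" by (simp add: algebra_simps)
    have "0 \<le> (1 - u) * (g p - g a)" "0 \<le> u * (g p - g b)"
      using u le[OF that(1)] le[OF that(2)] by auto
    with eq have "(1 - u) * (g p - g a) = 0" "u * (g p - g b) = 0" by linarith+
    then have "g a = g p" "g b = g p" using u by auto
    then show False using unique that u(3) by metis
  qed
  then show "p \<in> ext K" using p by (simp add: ext_def extreme_point_of_def)
qed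

text \<open>The alternative \<open>q = p\<close> serves the case of empty \<open>G\<close>, where
  the hull is \<open>{p}\<close>.\<close>

lemma convex_hull_insert_decompose:
  assumes "y \<in> convex hull (insert p G)"
  obtains t q where "0 \<le> t" "t \<le> 1" "q \<in> insert p (convex hull G)" "y = t *\<^sub>R p + (1 - t) *\<^sub>R q"
proof (cases "G = {}")
  case True
  then show thesis using that[of 1 p] assms by auto
next
  case False
  then obtain u v b where "0 \<le> u" "0 \<le> v" "u + v = 1" "b \<in> convex hull G" "y = u *\<^sub>R p + v *\<^sub>R b"
    using assms unfolding convex_hull_insert[OF False] by auto
  moreover from this have "v = 1 - u" by simp
  ultimately show thesis using that[of u b] by auto
qed

text \<open>For \<open>y = t *\<^sub>R p + (1 - t) *\<^sub>R q\<close>, the distance of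
  \<open>y\<close> from \<open>p\<close> and the drop of \<open>g\<close> from \<open>p\<close> to
  \<open>y\<close> are both proportional to \<open>1 - t\<close>. The gap \<open>d\<close> below
  \<open>g p\<close> thus bounds the distance by \<open>D / d\<close> times the drop. This
  inequality survives the closure, so the diameters of the slices shrink linearly.\<close>

lemma strongly_exposed_of_gap:
  fixes g :: "'a::real_normed_vector \<Rightarrow>\<^sub>L real"
  assumes top: "norm_topology N = euclidean"
    and K: "K = closure (convex hull (insert p G))"
    and gap: "\<And>q. q \<in> G \<Longrightarrow> blinfun_apply g q \<le> c" "c < blinfun_apply g p"
    and nz: "g \<noteq> 0"
    and bdd: "bounded K"
  shows "p \<in> str_exp N K"
proof -
  define d where "d = g p - c"
  have d: "0 < d" using gap by (simp add: d_def)
  obtain D where D: "\<And>a b. a \<in> K \<Longrightarrow> b \<in> K \<Longrightarrow> norm (a - b) \<le> D" "0 < D"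
  proof -
    obtain M where M: "\<And>a. a \<in> K \<Longrightarrow> norm a \<le> M" using bdd unfolding bounded_iff by auto
    \<comment> \<open>The summand 1 makes \<open>D\<close> positive, as it becomes a denominator
      below.\<close>
    have "norm (a - b) \<le> 2 * \<bar>M\<bar> + 1" if "a \<in> K" "b \<in> K" for a b
      using M[OF that(1)] M[OF that(2)] norm_triangle_ineq4[of a b] by linarith
    then show thesis using that[of "2 * \<bar>M\<bar> + 1"] by auto
  qed
  have sub: "insert p (convex hull G) \<subseteq> K"
    unfolding K using closure_subset hull_subset[of "insert p G" convex]
      hull_mono[of G "insert p G" convex] by blast
  have hull_le: "g q \<le> c" if "q \<in> convex hull G" for q
  proof -
    have "convex hull G \<subseteq> {q. g q \<le> c}"
    proof (rule hull_minimal)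
      show "convex {q. g q \<le> c}"
        by (rule convexI) (auto simp: blinfun.add_right blinfun.scaleR_right convex_bound_le)
    qed (use gap in auto)
    then show ?thesis using that by auto
  qed
  define P where "P = {y. g y \<le> g p \<and> norm (y - p) \<le> D / d * (g p - g y)}"
  have "closed P" unfolding P_def
    by (intro closed_Collect_conj closed_Collect_le continuous_intros)
  moreover have "convex hull (insert p G) \<subseteq> P"
  proof
    fix y assume "y \<in> convex hull (insert p G)"
    then obtain t q where t: "0 \<le> t" "t \<le> 1" and q: "q \<in> insert p (convex hull G)"
      and y: "y = t *\<^sub>R p + (1 - t) *\<^sub>R q" by (rule convex_hull_insert_decompose)
    have gy: "g p - g y = (1 - t) * (g p - g q)"
      unfolding y blinfun.add_right blinfun.scaleR_right by (simp add: algebra_simps)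
    have "y - p = (1 - t) *\<^sub>R (q - p)" unfolding y by (simp add: algebra_simps)
    then have ny: "norm (y - p) = (1 - t) * norm (q - p)" using t by simp
    show "y \<in> P"
    proof (cases "q = p")
      case True
      then show ?thesis using gy ny by (simp add: P_def)
    next
      case False
      then have gq: "d \<le> g p - g q" using q hull_le[of q] by (auto simp: d_def)
      have "norm (q - p) \<le> D" using q sub by (intro D) auto
      also have "D = D / d * d" using d by simp
      also have "\<dots> \<le> D / d * (g p - g q)" using gq D(2) d by (intro mult_left_mono) auto
      finally have "(1 - t) * norm (q - p) \<le> (1 - t) * (D / d * (g p - g q))"
        using t by (intro mult_left_mono) auto
      moreover have "0 \<le> (1 - t) * (g p - g q)" using t gq d by auto
      ultimately show ?thesis unfolding P_def mem_Collect_eq ny gy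
        using gy by (simp add: mult.left_commute)
    qed
  qed
  ultimately have KP: "K \<subseteq> P" unfolding K by (rule closure_minimal[rotated])
  have p: "p \<in> K" using sub by auto
  have le: "g y \<le> g p" if "y \<in> K" for y using KP that by (auto simp: P_def)
  have Sup: "Sup (g ` K) = g p"
    using p le by (intro cSup_eq_maximum) auto
  have "\<exists>\<alpha>>0. slice K g \<alpha> \<subseteq> V" if V: "open V" "p \<in> V" for V
  proof -
    obtain s where s: "s > 0" "\<And>y. dist y p < s \<Longrightarrow> y \<in> V" using V unfolding open_dist by blast
    \<comment> \<open>The depth \<open>s * d / D\<close> is the one that the factor
      \<open>D / d\<close> turns into the radius \<open>s\<close>.\<close>
    have "y \<in> V" if "y \<in> slice K g (s * d / D)" for y
    proof -
      have "norm (y - p) \<le> D / d * (g p - g y)" "g p - g y < s * d / D"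
        using that KP by (auto simp: slice_def Sup P_def)
      moreover from this have "D / d * (g p - g y) < D / d * (s * d / D)"
        using D d by (intro mult_strict_left_mono) auto
      ultimately have "norm (y - p) < s" using D d by simp
      then show ?thesis using s by (simp add: dist_norm)
    qed
    then show ?thesis using s d D by (intro exI[of _ "s * d / D"]) auto
  qed
  moreover have "\<exists>y. g y \<noteq> 0" using nz by (metis blinfun_eqI zero_blinfun.rep_eq)
  moreover have "linear g" by (simp add: blinfun.bounded_linear_right bounded_linear.linear)
  moreover have "continuous_map euclidean euclideanreal g"
    by (simp add: continuous_map_iff_continuous2 continuous_intros)
  moreover have "bdd_above (g ` K)" using le by (rule bdd_aboveI2)
  ultimately show ?thesis
    unfolding str_exp_def top mem_Collect_eq using p Sup
    by (intro conjI exI[of _ "blinfun_apply g"]) auto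
qed


section \<open>The renorming\<close>

context renorming_construction
begin

section \<open>The index set and the values of the functionals at the chosen points\<close>

lemma not_bounded_index: "\<exists>\<gamma> :: 'i. \<eta> < \<gamma>"
proof (rule ccontr)
  assume "\<not> ?thesis"
  \<comment> \<open>At a largest index the infimum in \<open>theta_inf\<close> would be the positive
    number \<open>\<theta> \<eta>\<close>.\<close>
  then have "{\<eta>..} = {\<eta>}" by (auto simp: not_less intro: order_antisym)
  then show False using theta_inf[of \<eta>] theta_range[of \<eta>] by simp
qed

lemma face_interiorD:
  assumes "v \<in> face_interior h" shows "blinfun_apply h v = 1" "norm v \<le> 1"
proof -
  have "v \<in> face h" using assms interior_of_subset[of _ "face h"] unfolding face_interior_def by blast
  then show "blinfun_apply h v = 1" "norm v \<le> 1" by (auto simp: face_def)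
qed

lemma norm_ep: "w \<in> A \<Longrightarrow> norm (ep w) \<le> 1" and norm_em: "w \<in> A \<Longrightarrow> norm (em w) \<le> 1"
  using ep_interior em_interior face_interiorD by blast+

lemma e_eq_1: "f \<gamma> (e \<gamma>) = 1" and norm_e: "norm (e \<gamma>) \<le> 1"
proof -
  have "f \<gamma> (e \<gamma>) = 1 \<and> norm (e \<gamma>) \<le> 1"
  proof (cases "\<gamma> \<in> A")
    case True
    then show ?thesis
      using face_interiorD[OF ep_interior[OF True]] face_interiorD[OF em_interior[OF True]]
        e_plus[OF True] e_minus[OF True]
      by (cases "lp \<gamma> \<ge> lm \<gamma>") (auto simp: blinfun.minus_left blinfun.minus_right)
  next
    case False
    then show ?thesis using face_interiorD e_other by blast
  qed
  then show "f \<gamma> (e \<gamma>) = 1" "norm (e \<gamma>) \<le> 1" by auto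
qed

lemma norm_f: "norm (f \<gamma>) = 1"
  using f_range by (auto simp: minimal_boundary_def)

lemma abs_f_e_le_mu: "\<xi> \<noteq> \<gamma> \<Longrightarrow> \<bar>f \<xi> (e \<gamma>)\<bar> \<le> \<mu> \<gamma>"
  unfolding \<mu>_def
proof (rule cSUP_upper)
  \<comment> \<open>The supremum bounds its terms once the set is bounded; here 1 is a
    bound.\<close>
  show "bdd_above ((\<lambda>\<xi>. \<bar>f \<xi> (e \<gamma>)\<bar>) ` (- {\<gamma>}))"
    using norm_blinfun[of "f _" "e \<gamma>"] norm_f norm_e[of \<gamma>]
    by (intro bdd_aboveI2[of _ _ 1]) (auto intro: order_trans)
qed simp

section \<open>The generators and elementary properties of \<open>B\<close>\<close>

definition generator :: "'i \<Rightarrow> 'a" where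
  "generator \<gamma> = (1 + \<tau> \<gamma>) *\<^sub>R e \<gamma>"

definition generators :: "'a set" where
  "generators = range generator \<union> range (\<lambda>\<gamma>. - generator \<gamma>)"

lemma B_eq: "B = closure (convex hull generators)"
  by (simp add: B_def generators_def generator_def)

lemma convex_B: "convex B" and closed_B: "closed B"
  by (simp_all add: B_eq convex_closure)

lemma generators_subset_B: "generators \<subseteq> B"
  unfolding B_eq using hull_subset closure_subset by (metis order_trans)

lemma minus_mem_B:
  assumes "v \<in> B" shows "- v \<in> B"
proof -
  have "uminus ` generators = generators" by (auto simp: generators_def image_Un image_image)
  then have "uminus ` B = B"
    unfolding B_eq using closure_scaleR[of "- 1" "convex hull generators"]
      convex_hull_scaling[of "- 1" generators] by simp
  then show ?thesis using assms by blast
qed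

lemma norm_generator: "norm (generator \<gamma>) \<le> 1 + \<epsilon>"
proof -
  have "(1 + \<tau> \<gamma>) * norm (e \<gamma>) \<le> (1 + \<epsilon>) * 1"
    using tau_range[of \<gamma>] norm_e[of \<gamma>] by (intro mult_mono) auto
  then show ?thesis using tau_range[of \<gamma>] by (simp add: generator_def)
qed

lemma B_subset_cball: "B \<subseteq> cball 0 (1 + \<epsilon>)"
  unfolding B_eq using norm_generator
  by (intro closure_minimal hull_minimal) (auto simp: generators_def)

lemma zero_mem_B: "0 \<in> B"
proof -
  have "(1 / 2) *\<^sub>R generator \<gamma> + (1 / 2) *\<^sub>R (- generator \<gamma>) \<in> B" for \<gamma>
    using generators_subset_B by (intro convexD[OF convex_B]) (auto simp: generators_def)
  then show ?thesis by simp
qed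

section \<open>A ball around the origin inside \<open>B\<close>\<close>

lemma scaleR_mem_B:
  assumes "v \<in> B" "0 \<le> t" "t \<le> 1" shows "t *\<^sub>R v \<in> B"
  using convexD[OF convex_B assms(1) zero_mem_B, of t "1 - t"] assms by simp

lemma e_mem_B: "e \<gamma> \<in> B" "- e \<gamma> \<in> B"
proof -
  have "0 < 1 + \<tau> \<gamma>" using tau_range[of \<gamma>] by simp
  then have "inverse (1 + \<tau> \<gamma>) *\<^sub>R generator \<gamma> \<in> B"
    using generators_subset_B tau_range[of \<gamma>]
    by (intro scaleR_mem_B) (auto simp: generators_def inverse_le_1_iff)
  then show "e \<gamma> \<in> B" using \<open>0 < 1 + \<tau> \<gamma>\<close> by (simp add: generator_def)
  then show "- e \<gamma> \<in> B" by (rule minus_mem_B)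
qed

text \<open>The heavier points \<open>p w\<close>, of total weight \<open>s\<close>, have their
  weighted mean \<open>(1 / s) *\<^sub>R u\<close> in \<open>B\<close>. Taking half of this mean
  away from \<open>u\<close> leaves norm at most \<open>s - 1 / 2\<close>, and the lighter points
  \<open>q w\<close> add at most \<open>1 - s\<close>, so the remainder \<open>v\<close> has norm at
  most 1/2 whatever \<open>s\<close> is.\<close>

lemma weighted_point_decompose:
  assumes "\<gamma> \<in> J" "\<eta> < \<kappa> \<gamma>"
  obtains c v where "c \<in> B" "norm v \<le> 1 / 2"
    "(\<Sum>w\<in>S \<gamma> \<eta>. lp w *\<^sub>R ep w + lm w *\<^sub>R em w) = (1 / 2) *\<^sub>R c + v"
proof -
  define T where "T = S \<gamma> \<eta>"
  have T: "finite T" "T \<subseteq> A"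
    using S_finite[OF assms] assms unfolding T_def A_def A_stage_def by auto
  define a b where "a w = max (lp w) (lm w)" and "b w = min (lp w) (lm w)" for w
  define p q where "p w = (if lm w \<le> lp w then ep w else em w)"
    and "q w = (if lm w \<le> lp w then em w else ep w)" for w
  have pq: "p w \<in> B" "norm (p w) \<le> 1" "norm (q w) \<le> 1" if "w \<in> T" for w
  proof -
    have w: "w \<in> A" using that T by auto
    \<comment> \<open>The construction picks \<open>e w\<close> by the same comparison of weights;
      the sign is harmless as \<open>B\<close> is symmetric.\<close>
    have "p w = e w \<or> p w = - e w" using e_plus[OF w] e_minus[OF w] by (auto simp: p_def)
    then show "p w \<in> B" using e_mem_B[of w] by metis
    show "norm (p w) \<le> 1" "norm (q w) \<le> 1" using norm_ep[OF w] norm_em[OF w] by (auto simp: p_def q_def)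
  qed
  have nonneg: "0 \<le> b w" "b w \<le> a w" if "w \<in> T" for w
    using that T weights_nonneg[of w] by (auto simp: a_def b_def)
  define s where "s = sum a T"
  have sum_b: "sum b T = 1 - s"
  proof -
    have "sum a T + sum b T = (\<Sum>w\<in>T. lp w + lm w)"
      unfolding sum.distrib[symmetric] by (rule sum.cong) (auto simp: a_def b_def)
    then show ?thesis using weights_sum[OF assms] by (simp add: s_def T_def)
  qed
  have "sum b T \<le> s" unfolding s_def using nonneg by (intro sum_mono) auto
  then have s: "1 / 2 \<le> s" using sum_b by simp
  define u where "u = (\<Sum>w\<in>T. a w *\<^sub>R p w)"
  have split: "(\<Sum>w\<in>T. lp w *\<^sub>R ep w + lm w *\<^sub>R em w) = u + (\<Sum>w\<in>T. b w *\<^sub>R q w)"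
    unfolding u_def sum.distrib[symmetric] by (rule sum.cong) (auto simp: a_def b_def p_def q_def)
  have c: "(1 / s) *\<^sub>R u \<in> B"
  proof -
    have "(\<Sum>w\<in>T. (a w / s) *\<^sub>R p w) \<in> B"
    proof (rule convex_sum[OF T(1) convex_B])
      show "(\<Sum>w\<in>T. a w / s) = 1" using s by (simp add: sum_divide_distrib[symmetric] s_def[symmetric])
      show "0 \<le> a w / s" if "w \<in> T" for w
        using nonneg[OF that] s by (intro divide_nonneg_nonneg) auto
    qed (use pq in auto)
    then show ?thesis by (simp add: u_def scaleR_sum_right)
  qed
  have nu: "norm u \<le> s"
    unfolding u_def s_def
  proof (rule sum_norm_le)
    fix w assume w: "w \<in> T"
    have "a w * norm (p w) \<le> a w * 1" using nonneg[OF w] pq[OF w] by (intro mult_left_mono) auto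
    then show "norm (a w *\<^sub>R p w) \<le> a w" using nonneg[OF w] by simp
  qed
  have nb: "norm (\<Sum>w\<in>T. b w *\<^sub>R q w) \<le> sum b T"
  proof (rule sum_norm_le)
    fix w assume w: "w \<in> T"
    have "b w * norm (q w) \<le> b w * 1" using nonneg[OF w] pq[OF w] by (intro mult_left_mono) auto
    then show "norm (b w *\<^sub>R q w) \<le> b w" using nonneg[OF w] by simp
  qed
  define v where "v = (1 - 1 / (2 * s)) *\<^sub>R u + (\<Sum>w\<in>T. b w *\<^sub>R q w)"
  have "norm ((1 - 1 / (2 * s)) *\<^sub>R u) \<le> (1 - 1 / (2 * s)) * s"
  proof -
    have "0 \<le> 1 - 1 / (2 * s)" using s by (simp add: field_simps)
    then show ?thesis using nu by (simp add: mult_left_mono)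
  qed
  also have "\<dots> = s - 1 / 2" using s by (simp add: field_simps)
  finally have "norm v \<le> 1 / 2"
    unfolding v_def using nb sum_b by (intro order_trans[OF norm_triangle_ineq]) simp
  moreover have "(\<Sum>w\<in>T. lp w *\<^sub>R ep w + lm w *\<^sub>R em w) = (1 / 2) *\<^sub>R ((1 / s) *\<^sub>R u) + v"
    unfolding split v_def by (simp add: scaleR_diff_left)
  ultimately show thesis using that c unfolding T_def by blast
qed

lemma ball_decompose:
  assumes "norm y \<le> 1"
  obtains c y' where "c \<in> B" "norm y' \<le> 1" "y = (1 / 2) *\<^sub>R c + (3 / 4) *\<^sub>R y'"
proof -
  \<comment> \<open>Density and the stage error contribute 1/8 each; with the remainder 1/2 from
    \<open>weighted_point_decompose\<close> this makes 3/4.\<close>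
  obtain i where i: "norm (y - x i) < 1 / 8"
    using subsetD[OF x_dense, of y] assms unfolding closure_approachable
    by (force simp: dist_norm norm_minus_commute dest!: spec[of _ "1 / 8"])
  \<comment> \<open>Lying above \<open>zero\<close> and \<open>omega\<close> gives membership in
    \<open>J\<close> in both cases of its definition; if the index type is countable,
    \<open>omega\<close> is just some unspecified element. Lying above \<open>i\<close> puts
    \<open>x i\<close> into \<open>W \<gamma>\<close>.\<close>
  obtain j where j: "max i (max zero omega) < j" using not_bounded_index by blast
  obtain \<gamma> where \<gamma>: "j \<le> \<gamma>" "\<theta> \<gamma> < 1 / 8"
  proof -
    have "(INF \<gamma>\<in>{j..}. \<theta> \<gamma>) < 1 / 8" using theta_inf[of j] by simp
    then show thesis using cInf_lessD[of "\<theta> ` {j..}" "1 / 8"] that by auto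
  qed
  have J: "\<gamma> \<in> J" "i < \<gamma>" using j \<gamma> by (auto simp: J_def)
  then have "x i \<in> z \<gamma> ` {..<\<kappa> \<gamma>}" using z_enum by (simp add: W_def)
  then obtain \<eta> where \<eta>: "\<eta> < \<kappa> \<gamma>" "x i = z \<gamma> \<eta>" by auto
  define u where "u = (\<Sum>w\<in>S \<gamma> \<eta>. lp w *\<^sub>R ep w + lm w *\<^sub>R em w)"
  obtain c v where c: "c \<in> B" "norm v \<le> 1 / 2" "u = (1 / 2) *\<^sub>R c + v"
    unfolding u_def using weighted_point_decompose[OF J(1) \<eta>(1)] by metis
  have "norm (x i - u) < 1 / 8"
    using z_approx[OF J(1) \<eta>(1)] \<gamma>(2) \<eta>(2) by (simp add: u_def dist_norm norm_minus_commute)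
  then have "norm ((y - x i) + (x i - u) + v) \<le> 3 / 4"
    using i c(2) norm_triangle_ineq[of "(y - x i) + (x i - u)" v]
      norm_triangle_ineq[of "y - x i" "x i - u"] by linarith
  then have "norm (y - (1 / 2) *\<^sub>R c) \<le> 3 / 4" using c(3) by (simp add: algebra_simps)
  then show thesis
    using that[of c "(4 / 3) *\<^sub>R (y - (1 / 2) *\<^sub>R c)"] c(1) by simp
qed

text \<open>Iteration of \<open>ball_decompose\<close>. The factor 2 is half the sum of the
  geometric series with ratio 3/4. It is also what makes the new coefficients 1/4 and 3/4 sum to 1,
  so that each approximant stays in \<open>B\<close> by convexity.\<close>

lemma ball_approx:
  "norm y \<le> 1 \<Longrightarrow> \<exists>c\<in>B. norm (y - 2 *\<^sub>R c) \<le> (3 / 4) ^ n"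
proof (induction n arbitrary: y)
  case 0
  then show ?case using zero_mem_B by (intro bexI[of _ 0]) auto
next
  case (Suc n)
  obtain c y' where c: "c \<in> B" "norm y' \<le> 1" "y = (1 / 2) *\<^sub>R c + (3 / 4) *\<^sub>R y'"
    using ball_decompose[OF Suc.prems] .
  obtain c' where c': "c' \<in> B" "norm (y' - 2 *\<^sub>R c') \<le> (3 / 4) ^ n" using Suc.IH c(2) by blast
  have "(1 / 4) *\<^sub>R c + (3 / 4) *\<^sub>R c' \<in> B" using c c' by (intro convexD[OF convex_B]) auto
  moreover have "y - 2 *\<^sub>R ((1 / 4) *\<^sub>R c + (3 / 4) *\<^sub>R c') = (3 / 4) *\<^sub>R (y' - 2 *\<^sub>R c')"
    unfolding c(3) by (simp add: algebra_simps)
  ultimately show ?case using c' by (intro bexI) auto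
qed

text \<open>The factor 2 of \<open>ball_approx\<close> costs half the radius, and closedness of
  \<open>B\<close> absorbs the error \<open>(3 / 4) ^ n\<close>.\<close>

lemma cball_subset_B: "cball 0 (1 / 2) \<subseteq> B"
proof
  fix v :: 'a assume "v \<in> cball 0 (1 / 2)"
  then have "norm (2 *\<^sub>R v) \<le> 1" by simp
  then have "\<forall>n. \<exists>c\<in>B. norm (2 *\<^sub>R v - 2 *\<^sub>R c) \<le> (3 / 4) ^ n" using ball_approx by blast
  then obtain c where c: "\<And>n. c n \<in> B" "\<And>n. norm (2 *\<^sub>R v - 2 *\<^sub>R c n) \<le> (3 / 4) ^ n" by metis
  have "norm (c n - v) \<le> (3 / 4) ^ n" for n
  proof -
    have "2 * norm (c n - v) = norm (2 *\<^sub>R v - 2 *\<^sub>R c n)"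
      by (metis abs_numeral norm_minus_commute norm_scaleR scaleR_diff_right)
    then show ?thesis using c(2)[of n] norm_ge_zero[of "c n - v"] by linarith
  qed
  then have "\<forall>\<^sub>F n in sequentially. norm (c n - v) \<le> (3 / 4) ^ n" by simp
  moreover have "(\<lambda>n. (3 / 4 :: real) ^ n) \<longlonglongrightarrow> 0" by (rule LIMSEQ_realpow_zero) auto
  ultimately have "(\<lambda>n. c n - v) \<longlonglongrightarrow> 0" by (rule Lim_null_comparison)
  then have "c \<longlonglongrightarrow> v" by (rule LIM_zero_cancel)
  then show "v \<in> B" using c(1) closed_B by (metis closed_sequentially)
qed

section \<open>Strong exposure of the generators and the closed convex hulls\<close>

sublocale symmetric_body B "1 / 2" "1 + \<epsilon>"
  using convex_B closed_B minus_mem_B cball_subset_B B_subset_cball by unfold_locales auto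

text \<open>The generator with sign \<open>\<sigma>\<close> and index \<open>\<gamma>\<close> is
  exposed by \<open>\<sigma> *\<^sub>R f \<gamma>\<close>: \<open>strongly_exposed_of_gap\<close>
  applies with \<open>c = 1\<close>, the value at the generator being
  \<open>1 + \<tau> \<gamma>\<close>.\<close>

lemma generators_subset_str_exp: "generators \<subseteq> str_exp norm_X B"
proof
  fix p assume "p \<in> generators"
  then obtain \<gamma> \<sigma> where \<sigma>: "\<sigma> = 1 \<or> \<sigma> = (- 1 :: real)" and p: "p = \<sigma> *\<^sub>R generator \<gamma>"
    unfolding generators_def by force
  define G where "G = generators - {p}"
  define g where "g = \<sigma> *\<^sub>R f \<gamma>"
  have gp: "g p = 1 + \<tau> \<gamma>"
    using \<sigma> e_eq_1[of \<gamma>] by (auto simp: p g_def generator_def blinfun.scaleR_left blinfun.scaleR_right)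
  have "g q \<le> 1" if q: "q \<in> G" for q
  proof -
    obtain \<xi> \<rho> where \<rho>: "\<rho> = 1 \<or> \<rho> = (- 1 :: real)" and q': "q = \<rho> *\<^sub>R generator \<xi>"
      using q unfolding G_def generators_def by force
    have gq: "g q = \<sigma> * \<rho> * ((1 + \<tau> \<xi>) * f \<gamma> (e \<xi>))"
      by (simp add: q' g_def generator_def blinfun.scaleR_left blinfun.scaleR_right)
    show ?thesis
    proof (cases "\<xi> = \<gamma>")
      \<comment> \<open>The only other generator with this index is \<open>- p\<close>, where
        \<open>g\<close> is negative.\<close>
      case True
      then have "\<rho> \<noteq> \<sigma>" using q by (auto simp: G_def p q')
      then have "g q = - (1 + \<tau> \<gamma>)" using gq \<sigma> \<rho> e_eq_1[of \<gamma>] True by auto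
      then show ?thesis using tau_range[of \<gamma>] by simp
    next
      case False
      have "g q \<le> \<bar>g q\<bar>" by simp
      also have "\<dots> = (1 + \<tau> \<xi>) * \<bar>f \<gamma> (e \<xi>)\<bar>"
        using gq \<sigma> \<rho> tau_range[of \<xi>] by (auto simp: abs_mult)
      also have "\<dots> \<le> (1 + \<tau> \<xi>) * \<mu> \<xi>"
        using abs_f_e_le_mu[of \<gamma> \<xi>] False tau_range[of \<xi>] by (intro mult_left_mono) auto
      \<comment> \<open>The condition \<open>tau_mu\<close> at the index of the other generator
        reads \<open>(1 + \<tau> \<xi>) * \<mu> \<xi> < 1 - \<tau> \<xi>\<close>.\<close>
      also have "\<dots> \<le> 1" using tau_mu[of \<xi>] tau_range[of \<xi>] by (simp add: algebra_simps)
      finally show ?thesis .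
    qed
  qed
  moreover have "1 < g p" using gp tau_range[of \<gamma>] by simp
  moreover have "B = closure (convex hull (insert p G))"
    using \<open>p \<in> generators\<close> by (simp add: G_def B_eq insert_absorb)
  moreover have "bounded B" using B_subset_cball bounded_cball bounded_subset by blast
  moreover have "g \<noteq> 0" using \<open>1 < g p\<close> by auto
  moreover have "norm_topology norm_X = euclidean"
    unfolding norm_X_def by (rule norm_topology_minkowski)
  ultimately show "p \<in> str_exp norm_X B" by (intro strongly_exposed_of_gap) auto
qed

lemma norm_ball_eq_closed_conv:
  "norm_ball norm_X = closed_conv norm_X (ext (norm_ball norm_X)) \<and>
   closed_conv norm_X (ext (norm_ball norm_X)) = closed_conv norm_X (str_exp norm_X (norm_ball norm_X))"
proof -
  have top: "norm_topology norm_X = euclidean"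
    unfolding norm_X_def by (rule norm_topology_minkowski)
  have ball: "norm_ball norm_X = B"
    unfolding norm_X_def by (rule norm_ball_minkowski)
  have conv: "closed_conv norm_X T = closure (convex hull T)" for T
    unfolding closed_conv_def top by simp
  \<comment> \<open>A cycle of inclusions from \<open>B\<close> through the hulls of the strongly
    exposed and of the extreme points back to \<open>B\<close> forces both equalities.\<close>
  have "B \<subseteq> closure (convex hull str_exp norm_X B)"
    unfolding B_eq using generators_subset_str_exp
    by (intro closure_mono hull_mono) (simp add: B_eq)
  moreover have "closure (convex hull str_exp norm_X B) \<subseteq> closure (convex hull ext B)"
    using str_exp_subset_ext[OF top] by (intro closure_mono hull_mono)
  moreover have "closure (convex hull ext B) \<subseteq> B"
    using convex_B closed_B
    by (intro closure_minimal hull_minimal) (auto simp: ext_def extreme_point_of_def)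
  ultimately show ?thesis unfolding ball conv by auto
qed

end

theorem theorem4p5:
  fixes \<epsilon> :: real
    and f :: "'i::wellorder \<Rightarrow> ('a::banach \<Rightarrow>\<^sub>L real)"
    and \<theta> :: "'i \<Rightarrow> real"
    and x :: "'i \<Rightarrow> 'a"
    and \<kappa> :: "'i \<Rightarrow> 'i"
    and z :: "'i \<Rightarrow> 'i \<Rightarrow> 'a"
    and S :: "'i \<Rightarrow> 'i \<Rightarrow> 'i set"
    and ep em :: "'i \<Rightarrow> 'a"
    and lp lm :: "'i \<Rightarrow> real"
    and e :: "'i \<Rightarrow> 'a"
    and \<tau> :: "'i \<Rightarrow> real"
    and N :: "'a \<Rightarrow> real"
  assumes "infinite_dimensional TYPE('a)"
    and "polyhedral TYPE('a)"
    and "property_double_star TYPE('a)"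
    and "0 < \<epsilon>"
    and "renorming_construction \<epsilon> f \<theta> x \<kappa> z S ep em lp lm e \<tau>"
    and "N = renorming_data.norm_X e \<tau>"
  shows "norm_ball N = closed_conv N (ext (norm_ball N)) \<and>
         closed_conv N (ext (norm_ball N)) = closed_conv N (str_exp N (norm_ball N))"
  using renorming_construction.norm_ball_eq_closed_conv[OF assms(5)] unfolding assms(6) .

end
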